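(* For every positive integer $n$, the algebra $\mathfrak{E}^{\{2,3\}}_{n+1}$ has a qualitative representation on a set of $2n$ points (i.e. on the complete graph $K_{2n}$).
   Context: Let $C=\{c_1,\dots,c_n\}$ and $C^+=\{1'\}\cup C$. The chromatic algebra $\mathfrak{E}^{\{2,3\}}_{n+1}$: a triple $(x,y,z)\in (C^+)^3$ is consistent if either one of $x,y,z$ equals $1'$ and the other two are equal, or $x,y,z\in C$ and $|\{x,y,z\}|\in\{2,3\}$ (i.e. not all equal). The algebra has universe the power set of $C^+$, set-theoretic Boolean operations ($0=\varnothing$, $1=C^+$), identity $\{1'\}$, converse the identity map, and composition $X;Y=\{z:(x,y,z)\text{ consistent for some }x\in X,y\in Y\}$; $\leq$ is inclusion. A qualitative representation of $\mathbf A$ on a set $U$ is an injective Boolean algebra homomorphism $\varphi$ from $\mathbf A$ into the power set of $U\times U$ with $\varphi(0)=\varnothing$, $\varphi(1)=U\times U$, $\varphi(1')=\mathrm{Id}_U$, $\varphi(\breve x)=\varphi(x)^{\smile}$, and $\varphi(x)\circ\varphi(y)\subseteq\varphi(z)$ iff $x;y\leq z$ for all $x,y,z$ ($\circ$ relational composition). *)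

theory Defs
  imports Main
begin

record 'a relation_algebra_type =
  universe :: "'a set"
  join :: "'a \<Rightarrow> 'a \<Rightarrow> 'a"
  meet :: "'a \<Rightarrow> 'a \<Rightarrow> 'a"
  complement :: "'a \<Rightarrow> 'a"
  zero :: 'a
  unit :: 'a
  comp :: "'a \<Rightarrow> 'a \<Rightarrow> 'a"
  conv :: "'a \<Rightarrow> 'a"
  ident :: 'a

definition below :: "'a relation_algebra_type \<Rightarrow> 'a \<Rightarrow> 'a \<Rightarrow> bool" where
  "below A x y \<longleftrightarrow> join A x y = y"

definition boolean_hom_into_Pow ::
    "'a relation_algebra_type \<Rightarrow> 'p set \<Rightarrow> ('a \<Rightarrow> 'p set) \<Rightarrow> bool" where
  "boolean_hom_into_Pow A P \<phi> \<longleftrightarrow>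
     (\<forall>x \<in> universe A. \<phi> x \<subseteq> P) \<and>
     (\<forall>x \<in> universe A. \<forall>y \<in> universe A. \<phi> (join A x y) = \<phi> x \<union> \<phi> y) \<and>
     (\<forall>x \<in> universe A. \<forall>y \<in> universe A. \<phi> (meet A x y) = \<phi> x \<inter> \<phi> y) \<and>
     (\<forall>x \<in> universe A. \<phi> (complement A x) = P - \<phi> x) \<and>
     \<phi> (zero A) = {} \<and>
     \<phi> (unit A) = P"

definition qualitative_representation ::
    "'a relation_algebra_type \<Rightarrow> 'u set \<Rightarrow> ('a \<Rightarrow> ('u \<times> 'u) set) \<Rightarrow> bool" where
  "qualitative_representation A U \<phi> \<longleftrightarrow>
     boolean_hom_into_Pow A (U \<times> U) \<phi> \<and>
     inj_on \<phi> (universe A) \<and>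
     \<phi> (ident A) = Id_on U \<and>
     (\<forall>x \<in> universe A. \<phi> (conv A x) = (\<phi> x)\<inverse>) \<and>
     (\<forall>x \<in> universe A. \<forall>y \<in> universe A. \<forall>z \<in> universe A.
        \<phi> x O \<phi> y \<subseteq> \<phi> z \<longleftrightarrow> below A (comp A x y) z)"

(* Diversity i stands for the colour c_i and Identity for the atom 1'. *)
datatype atom = Identity | Diversity nat

definition colours :: "nat \<Rightarrow> atom set" where
  "colours n = Diversity ` {1..n}"

definition atoms :: "nat \<Rightarrow> atom set" where
  "atoms n = insert Identity (colours n)"

definition consistent :: "nat \<Rightarrow> atom \<Rightarrow> atom \<Rightarrow> atom \<Rightarrow> bool" where
  "consistent n x y z \<longleftrightarrow>
     x \<in> atoms n \<and> y \<in> atoms n \<and> z \<in> atoms n \<and>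
     ((x = Identity \<and> y = z) \<or> (y = Identity \<and> x = z) \<or> (z = Identity \<and> x = y) \<or>
      (x \<in> colours n \<and> y \<in> colours n \<and> z \<in> colours n \<and> card {x, y, z} \<in> {2, 3}))"

(* The parameter n counts the colours, so there are n + 1 atoms. *)
definition chromatic_algebra_23 :: "nat \<Rightarrow> atom set relation_algebra_type" where
  "chromatic_algebra_23 n =
     \<lparr> universe = Pow (atoms n),
       join = (\<union>),
       meet = (\<inter>),
       complement = (\<lambda>X. atoms n - X),
       zero = {},
       unit = atoms n,
       comp = (\<lambda>X Y. {z. \<exists>x \<in> X. \<exists>y \<in> Y. consistent n x y z}),
       conv = (\<lambda>X. X),
       ident = {Identity} \<rparr>"

lemma below_chromatic_algebra_23: "below (chromatic_algebra_23 n) X Y \<longleftrightarrow> X \<subseteq> Y"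
  by (auto simp: below_def chromatic_algebra_23_def)

end

(* Label the edge {a, b} of the complete graph on Z/2n by the half (rounded down) of
   (a + b) mod 2n. Two edges sharing a vertex have different sums, while a colour admits
   only two sums, so there is no monochromatic triangle. Conversely, the sums 2i, 2j, 2k
   give the triangle i + k - j, i + j - k, j + k - i with colours i, j, k, and the sums
   2i, 2i + 1, 2j + 1 give the triangle j, 2i - j, j + 1 with colours i, i, j. *)
theory Submission
  imports Defs
begin

section \<open>Representations obtained from edge labellings\<close>

lemma consistent_Identity_right [simp]: "consistent n x Identity x \<longleftrightarrow> x \<in> atoms n"
  by (auto simp: consistent_def atoms_def)

lemma mem_colours_iff: "x \<in> colours n \<longleftrightarrow> (\<exists>i<n. x = Diversity (Suc i))"
  unfolding colours_def image_Suc_lessThan[symmetric] by auto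

text \<open>Reduces the algebra to a colouring problem: preimages under a labelling respect the
  Boolean operations. In the composition clause, realising every consistent triple gives the
  direction from relations to atoms, and having only consistent triangles gives the
  converse.\<close>

lemma qualitative_representation_of_labelling:
  fixes lab :: "'u \<Rightarrow> 'u \<Rightarrow> atom"
  assumes labels: "\<And>a b. a \<in> U \<Longrightarrow> b \<in> U \<Longrightarrow> lab a b \<in> atoms n"
    and Identity_iff: "\<And>a b. a \<in> U \<Longrightarrow> b \<in> U \<Longrightarrow> lab a b = Identity \<longleftrightarrow> a = b"
    and sym: "\<And>a b. a \<in> U \<Longrightarrow> b \<in> U \<Longrightarrow> lab a b = lab b a"
    and triangles: "\<And>x y z. consistent n x y z \<longleftrightarrow>
      (\<exists>a\<in>U. \<exists>b\<in>U. \<exists>c\<in>U. lab a b = x \<and> lab b c = y \<and> lab a c = z)"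
  shows "qualitative_representation (chromatic_algebra_23 n) U
           (\<lambda>X. {(a, b). a \<in> U \<and> b \<in> U \<and> lab a b \<in> X})"
    (is "qualitative_representation ?A U ?\<phi>")
proof -
  \<comment> \<open>The degenerate triple (x, \<open>Identity\<close>, x) is consistent, so every
    atom labels some pair; this yields injectivity.\<close>
  have used: "\<exists>a\<in>U. \<exists>b\<in>U. lab a b = x" if "x \<in> atoms n" for x
    using that triangles[of x Identity x] by auto
  have "boolean_hom_into_Pow ?A (U \<times> U) ?\<phi>"
    using labels by (auto simp: boolean_hom_into_Pow_def chromatic_algebra_23_def)
  moreover have "inj_on ?\<phi> (universe ?A)"
  proof (rule inj_onI)
    fix X Y assume XY: "X \<in> universe ?A" "Y \<in> universe ?A" "?\<phi> X = ?\<phi> Y"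
    have "x \<in> X \<longleftrightarrow> x \<in> Y" if x: "x \<in> atoms n" for x
    proof -
      obtain a b where "a \<in> U" "b \<in> U" "lab a b = x"
        using used[OF x] by blast
      then have "x \<in> X \<longleftrightarrow> (a, b) \<in> ?\<phi> X" "x \<in> Y \<longleftrightarrow> (a, b) \<in> ?\<phi> Y"
        by auto
      with XY(3) show ?thesis by simp
    qed
    with XY(1,2) show "X = Y" by (auto simp: chromatic_algebra_23_def)
  qed
  moreover have "?\<phi> (ident ?A) = Id_on U"
    using Identity_iff by (auto simp: chromatic_algebra_23_def)
  moreover have "?\<phi> (conv ?A X) = (?\<phi> X)\<inverse>" for X
    using sym by (auto simp: chromatic_algebra_23_def)
  moreover have "?\<phi> X O ?\<phi> Y \<subseteq> ?\<phi> Z \<longleftrightarrow> below ?A (comp ?A X Y) Z" for X Y Z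
    unfolding below_chromatic_algebra_23
    by (auto simp: chromatic_algebra_23_def triangles) blast
  ultimately show ?thesis
    by (simp add: qualitative_representation_def)
qed

section \<open>The half-sum labelling\<close>

definition half_sum_label :: "nat \<Rightarrow> int \<Rightarrow> int \<Rightarrow> atom" where
  "half_sum_label n a b =
     (if a mod (2 * int n) = b mod (2 * int n) then Identity
      else Diversity (Suc (nat ((a + b) mod (2 * int n) div 2))))"

lemma half_sum_label_commute: "half_sum_label n a b = half_sum_label n b a"
  by (auto simp: half_sum_label_def add.commute)

text \<open>Labels depend on residues only, so triangles can be built from arbitrary integers and
  reduced at the very end.\<close>

lemma half_sum_label_mod [simp]:
  "half_sum_label n (a mod (2 * int n)) (b mod (2 * int n)) = half_sum_label n a b"
  by (simp add: half_sum_label_def mod_add_eq)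

lemma half_sum_label_self [simp]: "half_sum_label n a a = Identity"
  by (simp add: half_sum_label_def)

lemma half_sum_label_eq_Identity_iff:
  "half_sum_label n a b = Identity \<longleftrightarrow> a mod (2 * int n) = b mod (2 * int n)"
  by (simp add: half_sum_label_def)

lemma half_sum_label_in_atoms:
  assumes "n \<ge> 1"
  shows "half_sum_label n a b \<in> atoms n"
proof -
  have "0 \<le> (a + b) mod (2 * int n)" "(a + b) mod (2 * int n) < 2 * int n"
    using assms by simp_all
  then have "nat ((a + b) mod (2 * int n) div 2) < n" by linarith
  then show ?thesis
    by (auto simp: half_sum_label_def atoms_def colours_def)
qed

text \<open>Reads a colour off an integer sum: \<open>2 * int i + e\<close> already lies below
  \<open>2 * int n\<close>, so reduction leaves it alone. The divisibility hypothesis keeps the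
  endpoints distinct modulo 2n.\<close>

lemma half_sum_label_eq_Diversity:
  assumes "i < n" "a + b = 2 * int i + e" "e \<in> {0, 1}" "\<not> 2 * int n dvd a - b"
  shows "half_sum_label n a b = Diversity (Suc i)"
proof -
  have "(a + b) mod (2 * int n) = 2 * int i + e"
    using assms(1-3) by auto
  moreover have "(2 * int i + e) div 2 = int i"
    using assms(3) by auto
  ultimately show ?thesis
    using assms(4) by (simp add: half_sum_label_def mod_eq_dvd_iff)
qed

text \<open>Cancelling 2 leaves divisibility by n of a nonzero number smaller than n in absolute
  value.\<close>

lemma not_dvd_double_diff:
  assumes "i < n" "j < n" "i \<noteq> j"
  shows "\<not> 2 * int n dvd 2 * (int i - int j)"
proof
  assume "2 * int n dvd 2 * (int i - int j)"
  then have "int n dvd int i - int j"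
    unfolding dvd_mult_cancel_left by simp
  then have "\<bar>int n\<bar> \<le> \<bar>int i - int j\<bar>"
    using assms(3) by (intro dvd_imp_le_int) auto
  with assms show False by linarith
qed

lemma not_dvd_odd: "odd d \<Longrightarrow> \<not> 2 * int n dvd d"
  by (meson dvd_trans dvd_triv_left)

section \<open>Triangles of the half-sum labelling\<close>

definition half_sum_triangle :: "nat \<Rightarrow> atom \<Rightarrow> atom \<Rightarrow> atom \<Rightarrow> bool" where
  "half_sum_triangle n x y z \<longleftrightarrow>
     (\<exists>a b c. half_sum_label n a b = x \<and> half_sum_label n b c = y \<and> half_sum_label n a c = z)"

lemma half_sum_triangle_swap:
  assumes "half_sum_triangle n x y z"
  shows "half_sum_triangle n y x z"
proof -
  obtain a b c where "half_sum_label n a b = x" "half_sum_label n b c = y"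
    "half_sum_label n a c = z"
    using assms unfolding half_sum_triangle_def by blast
  then have "half_sum_label n c b = y" "half_sum_label n b a = x" "half_sum_label n c a = z"
    by (simp_all add: half_sum_label_commute)
  then show ?thesis
    unfolding half_sum_triangle_def by blast
qed

text \<open>The same triangle is read from b onwards. Together with
  \<open>half_sum_triangle_swap\<close>, which reads it backwards, this gives all permutations, so
  each colour pattern is built in one order only.\<close>

lemma half_sum_triangle_rotate:
  assumes "half_sum_triangle n x y z"
  shows "half_sum_triangle n y z x"
proof -
  obtain a b c where "half_sum_label n a b = x" "half_sum_label n b c = y"
    "half_sum_label n a c = z"
    using assms unfolding half_sum_triangle_def by blast
  then have "half_sum_label n b c = y" "half_sum_label n c a = z" "half_sum_label n b a = x"
    by (simp_all add: half_sum_label_commute)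
  then show ?thesis
    unfolding half_sum_triangle_def by blast
qed

lemma half_sum_triangle_distinct:
  assumes "i < n" "j < n" "k < n" "i \<noteq> j" "j \<noteq> k" "i \<noteq> k"
  shows "half_sum_triangle n (Diversity (Suc i)) (Diversity (Suc j)) (Diversity (Suc k))"
proof -
  \<comment> \<open>The unique solution of a + b = 2i, b + c = 2j, a + c = 2k; it is integral
    because all three sums are even.\<close>
  define a b c where "a = int i + int k - int j" and "b = int i + int j - int k"
    and "c = int j + int k - int i"
  have diffs: "a - b = 2 * (int k - int j)" "b - c = 2 * (int i - int k)"
    "a - c = 2 * (int i - int j)"
    and sums: "a + b = 2 * int i + 0" "b + c = 2 * int j + 0" "a + c = 2 * int k + 0"
    by (simp_all add: a_def b_def c_def)
  have "half_sum_label n a b = Diversity (Suc i)"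
    by (rule half_sum_label_eq_Diversity[OF assms(1) sums(1)])
      (simp, unfold diffs, rule not_dvd_double_diff, use assms in auto)
  moreover have "half_sum_label n b c = Diversity (Suc j)"
    by (rule half_sum_label_eq_Diversity[OF assms(2) sums(2)])
      (simp, unfold diffs, rule not_dvd_double_diff, use assms in auto)
  moreover have "half_sum_label n a c = Diversity (Suc k)"
    by (rule half_sum_label_eq_Diversity[OF assms(3) sums(3)])
      (simp, unfold diffs, rule not_dvd_double_diff, use assms in auto)
  ultimately show ?thesis
    unfolding half_sum_triangle_def by blast
qed

lemma half_sum_triangle_isosceles:
  assumes "i < n" "j < n" "i \<noteq> j"
  shows "half_sum_triangle n (Diversity (Suc i)) (Diversity (Suc i)) (Diversity (Suc j))"
proof -
  \<comment> \<open>The two edges of colour i meet at b and take the sums 2i and 2i + 1, whence c =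
    a + 1; then a + c = 2j + 1 fixes a.\<close>
  define a b c where "a = int j" and "b = 2 * int i - int j" and "c = int j + 1"
  have diffs: "a - b = 2 * (int j - int i)" "b - c = 2 * (int i - int j) - 1" "a - c = - 1"
    and sums: "a + b = 2 * int i + 0" "b + c = 2 * int i + 1" "a + c = 2 * int j + 1"
    by (simp_all add: a_def b_def c_def)
  have "half_sum_label n a b = Diversity (Suc i)"
    by (rule half_sum_label_eq_Diversity[OF assms(1) sums(1)])
      (simp, unfold diffs, rule not_dvd_double_diff, use assms in auto)
  moreover have "half_sum_label n b c = Diversity (Suc i)"
    by (rule half_sum_label_eq_Diversity[OF assms(1) sums(2)]) (simp, unfold diffs, rule not_dvd_odd, simp)
  moreover have "half_sum_label n a c = Diversity (Suc j)"
    by (rule half_sum_label_eq_Diversity[OF assms(2) sums(3)]) (simp, unfold diffs, rule not_dvd_odd, simp)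
  ultimately show ?thesis
    unfolding half_sum_triangle_def by blast
qed

lemma half_sum_triangle_degenerate:
  assumes "x \<in> atoms n"
  shows "half_sum_triangle n x Identity x"
proof -
  have "\<exists>a b. half_sum_label n a b = x"
  proof (cases x)
    case Identity
    then show ?thesis using half_sum_label_self by blast
  next
    case (Diversity m)
    with assms obtain i where i: "x = Diversity (Suc i)" "i < n"
      by (auto simp: atoms_def mem_colours_iff)
    \<comment> \<open>The odd sum is chosen because 0 and 2i would coincide for i = 0.\<close>
    have "half_sum_label n 0 (2 * int i + 1) = x"
      unfolding i(1) by (rule half_sum_label_eq_Diversity[OF i(2), where e = 1])
        (simp_all add: not_dvd_odd)
    then show ?thesis by blast
  qed
  then show ?thesis
    unfolding half_sum_triangle_def by (metis half_sum_label_self)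
qed

text \<open>Pigeonhole: only two nonnegative integers share a given half. Signs matter, as
  \<open>nat\<close> sends all negative halves to 0.\<close>

lemma nat_half_eq_cases:
  fixes p q r :: int
  assumes "0 \<le> p" "0 \<le> q" "0 \<le> r"
    and "nat (p div 2) = nat (q div 2)" "nat (p div 2) = nat (r div 2)"
  shows "p = q \<or> p = r \<or> q = r"
  using assms by linarith

lemma no_monochromatic_half_sum_triangle:
  assumes "half_sum_label n a b = Diversity m" "half_sum_label n b c = Diversity m"
    "half_sum_label n a c = Diversity m" "n \<ge> 1"
  shows False
proof -
  let ?s = "\<lambda>u v. (u + v) mod (2 * int n)"
  have neq: "a mod (2 * int n) \<noteq> b mod (2 * int n)" "b mod (2 * int n) \<noteq> c mod (2 * int n)"
    "a mod (2 * int n) \<noteq> c mod (2 * int n)"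
    using assms by (auto simp: half_sum_label_def)
  have nonneg: "0 \<le> ?s a b" "0 \<le> ?s b c" "0 \<le> ?s a c"
    using assms(4) by simp_all
  have "nat (?s a b div 2) = nat (?s b c div 2)" "nat (?s a b div 2) = nat (?s a c div 2)"
    using assms(1-3) neq by (auto simp: half_sum_label_def)
  with nonneg have "?s a b = ?s b c \<or> ?s a b = ?s a c \<or> ?s b c = ?s a c"
    by (rule nat_half_eq_cases)
  \<comment> \<open>Any two of the edges share a vertex; cancelling it from equal sums makes the
    other two endpoints congruent.\<close>
  with neq show False
    by (auto simp: mod_eq_dvd_iff dvd_diff_commute)
qed

lemma half_sum_triangle_iff_consistent:
  assumes "n \<ge> 1"
  shows "half_sum_triangle n x y z \<longleftrightarrow> consistent n x y z"
proof
  assume "half_sum_triangle n x y z"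
  then obtain a b c where l: "half_sum_label n a b = x" "half_sum_label n b c = y"
    "half_sum_label n a c = z"
    unfolding half_sum_triangle_def by blast
  then have atoms: "x \<in> atoms n" "y \<in> atoms n" "z \<in> atoms n"
    using half_sum_label_in_atoms[OF assms] by auto
  \<comment> \<open>\<open>Identity\<close> makes u and v congruent, not equal as integers, so
    replacing one by the other has to pass through residues.\<close>
  have congruent: "half_sum_label n u w = half_sum_label n v w"
    if "half_sum_label n u v = Identity" for u v w
    using that by (metis half_sum_label_eq_Identity_iff half_sum_label_mod)
  consider "x = Identity" | "y = Identity" | "z = Identity"
    | "x \<in> colours n" "y \<in> colours n" "z \<in> colours n"
    using atoms by (auto simp: atoms_def)
  then show "consistent n x y z"
  proof cases
    case 1
    then show ?thesis using l atoms congruent[of a b c] by (simp add: consistent_def)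
  next
    case 2
    then show ?thesis
      using l atoms congruent[of b c a] by (simp add: consistent_def half_sum_label_commute)
  next
    case 3
    then show ?thesis
      using l atoms congruent[of a c b] by (simp add: consistent_def half_sum_label_commute)
  next
    case 4
    then have "\<not> (x = y \<and> y = z)"
      using no_monochromatic_half_sum_triangle[OF _ _ _ assms] l
      by (auto simp: colours_def)
    then have "card {x, y, z} \<in> {2, 3}"
      by (auto simp: card_insert_if)
    with 4 atoms show ?thesis by (simp add: consistent_def)
  qed
next
  assume c: "consistent n x y z"
  then have atoms: "x \<in> atoms n" "y \<in> atoms n" "z \<in> atoms n"
    by (simp_all add: consistent_def)
  consider "x = Identity" "y = z" | "y = Identity" "x = z" | "z = Identity" "x = y"
    | "x \<in> colours n" "y \<in> colours n" "z \<in> colours n" "\<not> (x = y \<and> y = z)"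
    using c by (cases "x = y \<and> y = z") (auto simp: consistent_def)
  then show "half_sum_triangle n x y z"
  proof cases
    case 4
    then obtain i j k where ijk: "x = Diversity (Suc i)" "y = Diversity (Suc j)"
      "z = Diversity (Suc k)" "i < n" "j < n" "k < n"
      unfolding mem_colours_iff by blast
    \<comment> \<open>When exactly two colours agree, the triple is rotated until the odd one out
      comes last, as in \<open>half_sum_triangle_isosceles\<close>.\<close>
    consider "i = j" "j \<noteq> k" | "j = k" "i \<noteq> j" | "i = k" "i \<noteq> j"
      | "i \<noteq> j" "j \<noteq> k" "i \<noteq> k"
      using 4(4) ijk by auto
    then show ?thesis
    proof cases
      case 1
      then show ?thesis
        unfolding ijk(1-3) using ijk(4-6) by (auto intro: half_sum_triangle_isosceles)
    next
      case 2
      then have "half_sum_triangle n y z x"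
        unfolding ijk(1-3) using ijk(4-6) by (auto intro: half_sum_triangle_isosceles)
      then show ?thesis by (rule half_sum_triangle_rotate[OF half_sum_triangle_rotate])
    next
      case 3
      then have "half_sum_triangle n z x y"
        unfolding ijk(1-3) using ijk(4-6) by (auto intro: half_sum_triangle_isosceles)
      then show ?thesis by (rule half_sum_triangle_rotate)
    next
      case 4
      then show ?thesis
        unfolding ijk(1-3) using ijk(4-6) by (intro half_sum_triangle_distinct)
    qed
  next
    case 1
    with half_sum_triangle_swap[OF half_sum_triangle_degenerate[OF atoms(2)]] show ?thesis
      by simp
  next
    case 2
    with atoms half_sum_triangle_degenerate[of x n] show ?thesis by simp
  next
    case 3
    with half_sum_triangle_rotate[OF half_sum_triangle_swap[OF
        half_sum_triangle_degenerate[OF atoms(1)]]] show ?thesis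
      by simp
  qed
qed

section \<open>Restriction to 2n points\<close>

theorem theorem27:
  fixes n :: nat
  assumes "n \<ge> 1"
  shows "\<exists>(U :: nat set) \<phi>. finite U \<and> card U = 2 * n \<and>
           qualitative_representation (chromatic_algebra_23 n) U \<phi>"
proof -
  let ?U = "{..<2 * n}"
  let ?lab = "\<lambda>a b. half_sum_label n (int a) (int b)"
  \<comment> \<open>Least nonnegative representatives move an integer triangle into
    \<open>?U\<close> without changing its labels.\<close>
  let ?r = "\<lambda>a. nat (a mod (2 * int n))"
  have r: "?r a \<in> ?U" "int (?r a) = a mod (2 * int n)" for a
    using assms by (simp_all add: nat_less_iff)
  have "half_sum_triangle n x y z \<longleftrightarrow>
      (\<exists>a\<in>?U. \<exists>b\<in>?U. \<exists>c\<in>?U. ?lab a b = x \<and> ?lab b c = y \<and> ?lab a c = z)" for x y z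
  proof
    assume "half_sum_triangle n x y z"
    then obtain a b c where "half_sum_label n a b = x" "half_sum_label n b c = y"
      "half_sum_label n a c = z"
      unfolding half_sum_triangle_def by blast
    then have "?lab (?r a) (?r b) = x \<and> ?lab (?r b) (?r c) = y \<and> ?lab (?r a) (?r c) = z"
      unfolding r(2) by simp
    then show "\<exists>a\<in>?U. \<exists>b\<in>?U. \<exists>c\<in>?U. ?lab a b = x \<and> ?lab b c = y \<and> ?lab a c = z"
      using r(1) by blast
  qed (auto simp: half_sum_triangle_def)
  then have "consistent n x y z \<longleftrightarrow>
      (\<exists>a\<in>?U. \<exists>b\<in>?U. \<exists>c\<in>?U. ?lab a b = x \<and> ?lab b c = y \<and> ?lab a c = z)" for x y z
    using half_sum_triangle_iff_consistent[OF assms] by simp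
  then have "qualitative_representation (chromatic_algebra_23 n) ?U
      (\<lambda>X. {(a, b). a \<in> ?U \<and> b \<in> ?U \<and> ?lab a b \<in> X})"
    by (intro qualitative_representation_of_labelling)
      (auto simp: half_sum_label_in_atoms[OF assms] half_sum_label_eq_Identity_iff
        intro: half_sum_label_commute)
  moreover have "finite ?U" "card ?U = 2 * n"
    by simp_all
  ultimately show ?thesis
    by blast
qed

end
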